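(* Let $f:\mathbb{R}^d\to\mathbb{R}$ be glocally $(L,L_*,\delta)$-smooth and $\mu$-strongly convex with $\mu>0$. Let $0<\alpha\le 1/2$ and $0<\beta<1$. Let $w_0\in\mathbb{R}^d$, let $f_*$ be the infimum of $f$, put $\Delta_0=f(w_0)-f_*$, and let $\epsilon$ satisfy $\Delta_0>\delta>\epsilon>0$. For all $t\ge0$ let $w_{t+1}=w_t-\eta_t\nabla f(w_t)$, where $\eta_t$ is the step size returned by the Armijo forwardtracking-backtracking procedure with parameters $\alpha,\beta$ (defined in the context). Then $f(w_T)-f_*\le\epsilon$ for all integers $T$ with $$T\ge\frac{L}{2\beta\alpha\mu}\log\left(\frac{\Delta_0}{\delta}\right)+\frac{L_*}{2\beta\alpha\mu}\log\left(\frac{\delta}{\epsilon}\right)+1.$$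
   Context: $\|\cdot\|$ is the Euclidean norm, functions are differentiable, and $L,L_*,\delta>0$. Glocal smoothness: $f$ with infimum $f_*$ is glocally $(L,L_*,\delta)$-smooth if (i) $\|\nabla f(u)-\nabla f(v)\|\le L\|u-v\|$ for all $u,v\in\mathbb{R}^d$, and (ii) $\|\nabla f(u)-\nabla f(v)\|\le L_*\|u-v\|$ for all $u,v$ in the set $\{u: f(u)-f_*\le\delta\}$. Strong convexity: $f$ is $\mu$-strongly convex if $f(v)\ge f(u)+\langle\nabla f(u),v-u\rangle+\frac{\mu}{2}\|v-u\|^2$ for all $u,v\in\mathbb{R}^d$. Armijo forwardtracking-backtracking: at the iterate $w_t$, the Armijo condition for a step size $\eta>0$ is $$f(w_t-\eta\nabla f(w_t))\le f(w_t)-\alpha\eta\|\nabla f(w_t)\|^2.$$ Starting from some initial step size $\tilde\eta_t>0$, the procedure first multiplies the step size by $1/\beta$ repeatedly until the Armijo condition fails (forwardtracking), and then multiplies it by $\beta$ repeatedly until the Armijo condition holds (backtracking); the resulting value is $\eta_t$. If $\nabla f(w_t)=0$, then $w_{t+1}=w_t$. *)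

theory Defs
  imports "HOL-Analysis.Analysis" "HOL-Library.While_Combinator"
begin

text \<open>The description is meaningful only at points of differentiability.\<close>

definition grad :: "(real ^ 'n \<Rightarrow> real) \<Rightarrow> real ^ 'n \<Rightarrow> real ^ 'n" where
  "grad f x = (THE D. GDERIV f x :> D)"

lemma GDERIV_grad:
  assumes "f differentiable (at x)"
  shows "GDERIV f x :> grad f x"
proof -
  obtain f' where f': "(f has_derivative f') (at x)"
    using assms unfolding differentiable_def by blast
  have "f' = (\<lambda>h. h \<bullet> adjoint f' 1)"
  proof
    show "f' h = h \<bullet> adjoint f' 1" for h
      using adjoint_works[OF has_derivative_linear[OF f'], of h 1] by simp
  qed
  with f' have ex: "GDERIV f x :> adjoint f' 1"
    unfolding gderiv_def by (rule back_subst)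
  have uniq: "D = E" if D: "GDERIV f x :> D" and E: "GDERIV f x :> E" for D E
  proof -
    have "(\<lambda>h. h \<bullet> D) = (\<lambda>h. h \<bullet> E)"
      using D E unfolding gderiv_def by (rule has_derivative_unique)
    then have "(D - E) \<bullet> D = (D - E) \<bullet> E"
      by (rule fun_cong)
    then have "(D - E) \<bullet> (D - E) = 0"
      by (simp only: inner_diff_right diff_self)
    then show ?thesis
      by simp
  qed
  show ?thesis
    unfolding grad_def by (rule theI[where P = "\<lambda>D. GDERIV f x :> D", OF ex]) (rule uniq[OF _ ex])
qed

text \<open>The infimum is the conditionally complete one on the reals, so this is the intended notion
  only for functions that are bounded below; strongly convex functions are.\<close>

definition glocally_smooth :: "real \<Rightarrow> real \<Rightarrow> real \<Rightarrow> (real ^ 'n \<Rightarrow> real) \<Rightarrow> bool" where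
  "glocally_smooth L Lstar \<delta> f \<longleftrightarrow>
     (\<forall>u v. norm (grad f u - grad f v) \<le> L * norm (u - v)) \<and>
     (\<forall>u v. f u - (INF x. f x) \<le> \<delta> \<longrightarrow> f v - (INF x. f x) \<le> \<delta> \<longrightarrow>
        norm (grad f u - grad f v) \<le> Lstar * norm (u - v))"

definition strongly_convex :: "real \<Rightarrow> (real ^ 'n \<Rightarrow> real) \<Rightarrow> bool" where
  "strongly_convex \<mu> f \<longleftrightarrow>
     (\<forall>u v. f v \<ge> f u + grad f u \<bullet> (v - u) + \<mu> / 2 * (norm (v - u))\<^sup>2)"

definition armijo :: "(real ^ 'n \<Rightarrow> real) \<Rightarrow> real \<Rightarrow> real ^ 'n \<Rightarrow> real \<Rightarrow> bool" where
  "armijo f \<alpha> x \<eta> \<longleftrightarrow>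
     f (x - \<eta> *\<^sub>R grad f x) \<le> f x - \<alpha> * \<eta> * (norm (grad f x))\<^sup>2"

text \<open>If one of the loops does not terminate, the value is unspecified; termination is not built
  into the definition. In particular, at a stationary point every step size satisfies the Armijo
  condition and forwardtracking does not stop.\<close>

definition forwardtrack ::
  "(real ^ 'n \<Rightarrow> real) \<Rightarrow> real \<Rightarrow> real \<Rightarrow> real ^ 'n \<Rightarrow> real \<Rightarrow> real" where
  "forwardtrack f \<alpha> \<beta> x \<eta>\<^sub>0 = while (armijo f \<alpha> x) (\<lambda>\<eta>. \<eta> * (1 / \<beta>)) \<eta>\<^sub>0"

definition backtrack ::
  "(real ^ 'n \<Rightarrow> real) \<Rightarrow> real \<Rightarrow> real \<Rightarrow> real ^ 'n \<Rightarrow> real \<Rightarrow> real" where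
  "backtrack f \<alpha> \<beta> x \<eta>\<^sub>0 = while (\<lambda>\<eta>. \<not> armijo f \<alpha> x \<eta>) (\<lambda>\<eta>. \<eta> * \<beta>) \<eta>\<^sub>0"

definition armijo_search ::
  "(real ^ 'n \<Rightarrow> real) \<Rightarrow> real \<Rightarrow> real \<Rightarrow> real ^ 'n \<Rightarrow> real \<Rightarrow> real" where
  "armijo_search f \<alpha> \<beta> x \<eta>\<^sub>0 = backtrack f \<alpha> \<beta> x (forwardtrack f \<alpha> \<beta> x \<eta>\<^sub>0)"

end

theory Submission
  imports Defs
begin

text \<open>
  The search returns a step size \<open>\<eta>\<close> that satisfies the Armijo condition while \<open>\<eta> / \<beta>\<close> violates it.
  If the gradient is \<open>M\<close>-Lipschitz near the iterate, every step size up to \<open>1 / M\<close> satisfies the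
  condition (this is where \<open>\<alpha> \<le> 1 / 2\<close> enters), so \<open>\<eta> > \<beta> / M\<close>. The Armijo decrease then is at least
  \<open>\<alpha> \<beta> / M\<close> times the squared gradient norm, which strong convexity bounds below by \<open>2 \<mu>\<close> times the
  suboptimality gap. Hence each iteration multiplies the gap by at most
  \<open>1 - 2 \<alpha> \<beta> \<mu> / M \<le> exp (- 2 \<alpha> \<beta> \<mu> / M)\<close>.

  The delicate point is what ``near'' means: the violating trial point may have a larger function value
  than the iterate, so it may leave the set on which the constant \<open>Lstar\<close> is known. It is
  nevertheless enough that the gradient is \<open>M\<close>-Lipschitz on the sublevel set of the iterate,
  because a segment along the negative gradient cannot leave that set before length \<open>1 / M\<close>
  (lemma \<open>armijo_if_short_step\<close>). The one-step estimate \<open>armijo_search_contraction\<close> therefore holds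
  with \<open>M = L\<close> everywhere and with \<open>M = Lstar\<close> once the gap is at most \<open>\<delta>\<close>. As the gaps never
  increase, at most \<open>\<lceil>L / (2 \<beta> \<alpha> \<mu>) * ln (\<Delta>\<^sub>0 / \<delta>)\<rceil>\<close> iterations are spent above \<open>\<delta>\<close>, and the summand
  \<open>1\<close> in the bound on \<open>T\<close> pays for this rounding.
\<close>

section \<open>Strong convexity\<close>

text \<open>The quadratic lower bound at \<open>u\<close> is minimal where the step is \<open>- grad f u / \<mu>\<close>; completing the
  square gives a lower bound that does not depend on \<open>v\<close>.\<close>

lemma strongly_convex_lower_bound:
  assumes "strongly_convex \<mu> f" "\<mu> > 0"
  shows "f u - (norm (grad f u))\<^sup>2 / (2 * \<mu>) \<le> f v"
proof -
  let ?g = "grad f u"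
  define d where "d = v - u"
  have "0 \<le> (norm (?g + \<mu> *\<^sub>R d))\<^sup>2"
    by simp
  also have "\<dots> = (norm ?g)\<^sup>2 + 2 * \<mu> * (?g \<bullet> d) + \<mu>\<^sup>2 * (norm d)\<^sup>2"
    by (simp add: power2_norm_eq_inner inner_add_left inner_add_right inner_commute
        power2_eq_square[of \<mu>] algebra_simps)
  also have "\<dots> = 2 * \<mu> * ((norm ?g)\<^sup>2 / (2 * \<mu>) + ?g \<bullet> d + \<mu> / 2 * (norm d)\<^sup>2)"
    using assms(2) by (simp add: field_simps power2_eq_square)
  finally have "0 \<le> (norm ?g)\<^sup>2 / (2 * \<mu>) + ?g \<bullet> d + \<mu> / 2 * (norm d)\<^sup>2"
    using assms(2) by (simp add: zero_le_mult_iff)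
  moreover have "f v \<ge> f u + ?g \<bullet> d + \<mu> / 2 * (norm d)\<^sup>2"
    using assms(1) unfolding strongly_convex_def d_def by blast
  ultimately show ?thesis
    by linarith
qed

lemma strongly_convex_INF_le:
  assumes "strongly_convex \<mu> f" "\<mu> > 0"
  shows "(INF x. f x) \<le> f u"
  by (rule cINF_lower)
    (use strongly_convex_lower_bound[OF assms, of u] in \<open>auto intro!: bdd_belowI\<close>)

text \<open>The Polyak--Lojasiewicz inequality.\<close>

lemma strongly_convex_gap_le_gradient:
  assumes "strongly_convex \<mu> f" "\<mu> > 0"
  shows "2 * \<mu> * (f u - (INF x. f x)) \<le> (norm (grad f u))\<^sup>2"
proof -
  have "f u - (norm (grad f u))\<^sup>2 / (2 * \<mu>) \<le> (INF x. f x)"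
    by (rule cINF_greatest) (simp_all add: strongly_convex_lower_bound[OF assms])
  then show ?thesis
    using assms(2) by (simp add: field_simps)
qed

lemma strongly_convex_segment_le_max:
  assumes "strongly_convex \<mu> f" "\<mu> > 0" "0 \<le> t" "t \<le> 1"
  shows "f (a + t *\<^sub>R d) \<le> max (f a) (f (a + d))"
proof -
  let ?z = "a + t *\<^sub>R d"
  have supp: "f v \<ge> f ?z + grad f ?z \<bullet> (v - ?z)" for v
  proof -
    have "f v \<ge> f ?z + grad f ?z \<bullet> (v - ?z) + \<mu> / 2 * (norm (v - ?z))\<^sup>2"
      using assms(1) unfolding strongly_convex_def by blast
    moreover have "0 \<le> \<mu> / 2 * (norm (v - ?z))\<^sup>2"
      using assms(2) by simp
    ultimately show ?thesis by linarith
  qed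
  show ?thesis
  proof (cases "grad f ?z \<bullet> d \<ge> 0")
    case True
    have "(1 - t) * (grad f ?z \<bullet> d) \<ge> 0"
      using True assms(4) by simp
    then show ?thesis
      using supp[of "a + d"] by (simp add: algebra_simps inner_diff_right)
  next
    case False
    then have "t * (grad f ?z \<bullet> d) \<le> 0"
      using assms(3) by (simp add: mult_nonneg_nonpos)
    then show ?thesis
      using supp[of a] by (simp add: algebra_simps inner_diff_right)
  qed
qed

section \<open>Step sizes that satisfy the Armijo condition\<close>

lemma has_derivative_along_line:
  assumes "\<And>x. f differentiable (at x)"
  shows "((\<lambda>t. f (x + t *\<^sub>R d)) has_real_derivative grad f (x + t *\<^sub>R d) \<bullet> d) (at t)"
proof -
  have "((\<lambda>t. x + t *\<^sub>R d) has_derivative (\<lambda>h. h *\<^sub>R d)) (at t)"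
    by (auto intro!: derivative_eq_intros)
  moreover have "(f has_derivative (\<lambda>h. h \<bullet> grad f (x + t *\<^sub>R d))) (at (x + t *\<^sub>R d))"
    using GDERIV_grad[OF assms] unfolding gderiv_def .
  ultimately have "((\<lambda>t. f (x + t *\<^sub>R d)) has_derivative (\<lambda>h. (h *\<^sub>R d) \<bullet> grad f (x + t *\<^sub>R d))) (at t)"
    using has_derivative_compose by blast
  then show ?thesis
    unfolding has_field_derivative_def by (simp add: inner_commute mult_commute_abs)
qed

text \<open>The descent lemma, with the Lipschitz bound required only between \<open>x\<close> and the other points of
  the segment. The function minus its claimed upper bound has a nonpositive derivative along the
  segment, by Cauchy--Schwarz.\<close>

lemma descent_lemma_segment:
  assumes diff: "\<And>x. f differentiable (at x)"
    and lip: "\<And>t. 0 \<le> t \<Longrightarrow> t \<le> 1 \<Longrightarrow> norm (grad f (x + t *\<^sub>R d) - grad f x) \<le> M * (t * norm d)"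
  shows "f (x + d) \<le> f x + grad f x \<bullet> d + M / 2 * (norm d)\<^sup>2"
proof -
  define \<psi> where "\<psi> t = f (x + t *\<^sub>R d) - t * (grad f x \<bullet> d) - M / 2 * t\<^sup>2 * (norm d)\<^sup>2" for t
  have "\<psi> 1 \<le> \<psi> 0"
  proof (rule DERIV_nonpos_imp_nonincreasing[where f = \<psi>])
    fix t :: real
    assume t: "0 \<le> t" "t \<le> 1"
    let ?e = "grad f (x + t *\<^sub>R d) - grad f x"
    have "(\<psi> has_real_derivative grad f (x + t *\<^sub>R d) \<bullet> d - grad f x \<bullet> d - M * t * (norm d)\<^sup>2) (at t)"
      unfolding \<psi>_def
      by (auto intro!: derivative_eq_intros has_derivative_along_line[OF diff])
    moreover have "grad f (x + t *\<^sub>R d) \<bullet> d - grad f x \<bullet> d - M * t * (norm d)\<^sup>2 \<le> 0"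
    proof -
      have "?e \<bullet> d \<le> norm ?e * norm d"
        by (rule norm_cauchy_schwarz)
      also have "\<dots> \<le> M * (t * norm d) * norm d"
        by (intro mult_right_mono lip t) simp
      finally show ?thesis
        by (simp add: inner_diff_left power2_eq_square mult.assoc)
    qed
    ultimately show "\<exists>y. (\<psi> has_real_derivative y) (at t) \<and> y \<le> 0"
      by blast
  qed simp
  then show ?thesis
    by (simp add: \<psi>_def)
qed

text \<open>On a segment that starts and ends in the sublevel set of \<open>x\<close>, convexity keeps the whole segment
  in that set, so the descent lemma applies.\<close>

lemma gradient_step_decrease:
  assumes diff: "\<And>x. f differentiable (at x)"
    and sc: "strongly_convex \<mu> f" "\<mu> > 0"
    and lip: "\<And>u. f u \<le> f x \<Longrightarrow> norm (grad f u - grad f x) \<le> M * norm (u - x)"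
    and s: "0 \<le> s" "s \<le> 1 / M" "M > 0"
    and le: "f (x - s *\<^sub>R grad f x) \<le> f x"
  shows "f (x - s *\<^sub>R grad f x) \<le> f x - s / 2 * (norm (grad f x))\<^sup>2"
proof -
  let ?g = "grad f x"
  let ?d = "- (s *\<^sub>R ?g)"
  have "f (x + ?d) \<le> f x + ?g \<bullet> ?d + M / 2 * (norm ?d)\<^sup>2"
  proof (rule descent_lemma_segment[OF diff])
    fix t :: real
    assume t: "0 \<le> t" "t \<le> 1"
    have "f (x + t *\<^sub>R ?d) \<le> f x"
      using strongly_convex_segment_le_max[OF sc t, of x ?d] le by simp
    from lip[OF this] show "norm (grad f (x + t *\<^sub>R ?d) - ?g) \<le> M * (t * norm ?d)"
      using t s(1) by (simp add: abs_mult mult.assoc)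
  qed
  also have "\<dots> = f x - s * (norm ?g)\<^sup>2 + (s * M) * s / 2 * (norm ?g)\<^sup>2"
    by (simp add: dot_square_norm power_mult_distrib power2_eq_square[of s])
  also have "\<dots> \<le> f x - s * (norm ?g)\<^sup>2 + 1 * s / 2 * (norm ?g)\<^sup>2"
    using s by (intro add_left_mono mult_right_mono divide_right_mono) (simp_all add: field_simps)
  finally show ?thesis
    by simp
qed

text \<open>If a step of length at most \<open>1 / M\<close> increased \<open>f\<close>, then \<open>f\<close> would return to the value \<open>f x\<close> at an
  earlier positive step size, because it decreases at first. Up to there the segment lies in the
  sublevel set, so \<open>gradient_step_decrease\<close> gives a strict decrease, a contradiction.\<close>

lemma armijo_if_short_step:
  assumes diff: "\<And>x. f differentiable (at x)"
    and sc: "strongly_convex \<mu> f" "\<mu> > 0"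
    and lip: "\<And>u. f u \<le> f x \<Longrightarrow> norm (grad f u - grad f x) \<le> M * norm (u - x)"
    and s: "0 < s" "s \<le> 1 / M" "M > 0"
    and \<alpha>: "\<alpha> \<le> 1 / 2"
  shows "armijo f \<alpha> x s"
proof -
  let ?g = "grad f x"
  define \<phi> where "\<phi> t = f (x - t *\<^sub>R ?g)" for t
  note decr = gradient_step_decrease[OF diff sc lip]
  have d: "(\<phi> has_real_derivative - (grad f (x - t *\<^sub>R ?g) \<bullet> ?g)) (at t)" for t
    using has_derivative_along_line[OF diff, of x "- ?g" t] by (simp add: \<phi>_def[abs_def])
  have le: "f (x - s *\<^sub>R ?g) \<le> f x"
  proof (rule ccontr)
    assume gt: "\<not> f (x - s *\<^sub>R ?g) \<le> f x"
    then have g: "?g \<noteq> 0" by auto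
    then have "- (grad f (x - 0 *\<^sub>R ?g) \<bullet> ?g) < 0" by simp
    from DERIV_neg_dec_right[OF d this] obtain e
      where e: "e > 0" "\<And>h. 0 < h \<Longrightarrow> h < e \<Longrightarrow> \<phi> h < \<phi> 0" by auto
    define h where "h = min (e / 2) s"
    have h: "0 < h" "h \<le> s" "h < e"
      using e(1) s(1) by (auto simp: h_def)
    have "\<phi> h \<le> \<phi> 0" "\<phi> 0 \<le> \<phi> s"
      using e(2)[OF h(1,3)] gt by (auto simp: \<phi>_def)
    moreover have "\<forall>t. h \<le> t \<and> t \<le> s \<longrightarrow> isCont \<phi> t"
      using d DERIV_isCont by blast
    ultimately obtain r where r: "h \<le> r" "r \<le> s" "\<phi> r = \<phi> 0"
      using IVT[of \<phi> h "\<phi> 0" s] h by auto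
    have "f (x - r *\<^sub>R ?g) \<le> f x - r / 2 * (norm ?g)\<^sup>2"
      by (rule decr) (use r h s in \<open>auto simp: \<phi>_def\<close>)
    moreover have "r / 2 * (norm ?g)\<^sup>2 > 0"
      using r h g by simp
    ultimately show False
      using r(3) by (simp add: \<phi>_def)
  qed
  have "f (x - s *\<^sub>R ?g) \<le> f x - s / 2 * (norm ?g)\<^sup>2"
    by (rule decr) (use s le in auto)
  moreover have "\<alpha> * s * (norm ?g)\<^sup>2 \<le> s / 2 * (norm ?g)\<^sup>2"
    using mult_right_mono[OF \<alpha>, of s] s by (intro mult_right_mono) auto
  ultimately show ?thesis
    unfolding armijo_def by linarith
qed

text \<open>This makes forwardtracking stop: beyond \<open>2 / \<mu>\<close> the quadratic lower bound of strong convexity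
  already exceeds \<open>f x\<close>.\<close>

lemma not_armijo_if_long_step:
  assumes sc: "strongly_convex \<mu> f" "\<mu> > 0"
    and g: "grad f x \<noteq> 0" and "\<alpha> > 0" and s: "s > 2 / \<mu>"
  shows "\<not> armijo f \<alpha> x s"
proof
  let ?g = "grad f x"
  assume "armijo f \<alpha> x s"
  moreover have "f (x - s *\<^sub>R ?g) \<ge> f x + ?g \<bullet> (x - s *\<^sub>R ?g - x) + \<mu> / 2 * (norm (x - s *\<^sub>R ?g - x))\<^sup>2"
    using sc unfolding strongly_convex_def by blast
  moreover have "?g \<bullet> (x - s *\<^sub>R ?g - x) + \<mu> / 2 * (norm (x - s *\<^sub>R ?g - x))\<^sup>2
      = s * (norm ?g)\<^sup>2 * (\<mu> * s / 2 - 1)"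
    by (simp add: dot_square_norm power_mult_distrib power2_eq_square[of s] algebra_simps)
  moreover have s0: "s > 0"
    using s sc(2) by (meson divide_pos_pos less_trans zero_less_numeral)
  have "s * (norm ?g)\<^sup>2 * (\<mu> * s / 2 - 1) > 0"
    using s s0 g sc(2) by (intro mult_pos_pos) (simp_all add: field_simps)
  moreover have "\<alpha> * s * (norm ?g)\<^sup>2 > 0"
    using s0 g assms(4) by simp
  ultimately show False
    unfolding armijo_def by linarith
qed

section \<open>The search\<close>

lemma while_reaches_first_exit:
  assumes "\<not> b ((c ^^ n) s)"
  obtains k where "while b c s = (c ^^ k) s" "\<not> b ((c ^^ k) s)" "\<And>j. j < k \<Longrightarrow> b ((c ^^ j) s)"
proof
  let ?k = "LEAST k. \<not> b ((c ^^ k) s)"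
  show "while b c s = (c ^^ ?k) s"
    using assms unfolding while_def while_option_def by auto
  show "\<not> b ((c ^^ ?k) s)"
    using assms by (rule LeastI)
  show "b ((c ^^ j) s)" if "j < ?k" for j
    using not_less_Least[OF that] by blast
qed

lemma funpow_mult_right:
  fixes a s :: "'a :: comm_monoid_mult"
  shows "((\<lambda>x. x * a) ^^ n) s = s * a ^ n"
  by (induction n) (simp_all add: mult_ac)

text \<open>Backtracking starts at a step size rejected by forwardtracking, so it takes at least one step,
  and the last rejected value is the result divided by \<open>\<beta>\<close>.\<close>

lemma armijo_search_brackets:
  assumes \<beta>: "0 < \<beta>" "\<beta> < 1" and s0: "s0 > 0"
    and short: "r > 0" "\<And>s. 0 < s \<Longrightarrow> s \<le> r \<Longrightarrow> armijo f \<alpha> x s"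
    and long: "\<And>s. s > R \<Longrightarrow> \<not> armijo f \<alpha> x s"
  shows "armijo f \<alpha> x (armijo_search f \<alpha> \<beta> x s0)"
    and "armijo_search f \<alpha> \<beta> x s0 > \<beta> * r"
proof -
  define s1 where "s1 = forwardtrack f \<alpha> \<beta> x s0"
  obtain n where "R / s0 < (1 / \<beta>) ^ n"
    using real_arch_pow[of "1 / \<beta>" "R / s0"] \<beta> by auto
  then have "\<not> armijo f \<alpha> x (((\<lambda>\<eta>. \<eta> * (1 / \<beta>)) ^^ n) s0)"
    using s0 unfolding funpow_mult_right
    by (intro long) (simp add: divide_less_eq mult.commute)
  then obtain k where k: "s1 = s0 * (1 / \<beta>) ^ k" "\<not> armijo f \<alpha> x s1"
    by (rule while_reaches_first_exit)
      (auto simp: s1_def forwardtrack_def funpow_mult_right simp del: times_divide_eq_right)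
  have s1: "s1 > 0"
    using k(1) s0 \<beta> by simp
  obtain m where "\<beta> ^ m < r / s1"
    using real_arch_pow_inv[of "r / s1" \<beta>] \<beta> s1 short(1) by auto
  then have "\<not> \<not> armijo f \<alpha> x (((\<lambda>\<eta>. \<eta> * \<beta>) ^^ m) s1)"
    using s1 \<beta> unfolding funpow_mult_right
    by (simp add: short(2) less_divide_eq mult.commute)
  then obtain j where j: "armijo_search f \<alpha> \<beta> x s0 = s1 * \<beta> ^ j" "armijo f \<alpha> x (s1 * \<beta> ^ j)"
    "\<And>i. i < j \<Longrightarrow> \<not> armijo f \<alpha> x (s1 * \<beta> ^ i)"
    by (rule while_reaches_first_exit)
      (auto simp: s1_def[symmetric] armijo_search_def backtrack_def funpow_mult_right)
  show "armijo f \<alpha> x (armijo_search f \<alpha> \<beta> x s0)"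
    using j by simp
  have "j \<noteq> 0"
    using j(2) k(2) by (cases j) auto
  then obtain i where i: "j = Suc i"
    using not0_implies_Suc by blast
  have "r < s1 * \<beta> ^ i"
    using j(3)[of i] short(2)[of "s1 * \<beta> ^ i"] i s1 \<beta> by force
  then show "armijo_search f \<alpha> \<beta> x s0 > \<beta> * r"
    using \<beta>(1) by (simp add: j(1) i mult.left_commute)
qed

section \<open>Convergence\<close>

text \<open>At a stationary point the search need not stop and \<open>\<eta>\<close> is arbitrary, but then the iterate is already
  a minimiser and both sides are zero. Otherwise the guaranteed step size \<open>\<beta> / M\<close> and the
  Polyak--Lojasiewicz inequality give the factor \<open>1 - 2 \<beta> \<alpha> \<mu> / M\<close>; the exponential, which is never
  negative, is the form that can be iterated.\<close>

lemma armijo_search_contraction: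
  assumes diff: "\<And>x. f differentiable (at x)"
    and sc: "strongly_convex \<mu> f" "\<mu> > 0"
    and lip: "\<And>u. f u \<le> f x \<Longrightarrow> norm (grad f u - grad f x) \<le> M * norm (u - x)"
    and M: "M > 0" and \<alpha>: "0 < \<alpha>" "\<alpha> \<le> 1 / 2" and \<beta>: "0 < \<beta>" "\<beta> < 1" and s0: "s0 > 0"
    and \<eta>: "grad f x \<noteq> 0 \<Longrightarrow> \<eta> = armijo_search f \<alpha> \<beta> x s0"
  shows "f (x - \<eta> *\<^sub>R grad f x) - (INF x. f x)
    \<le> exp (- (2 * \<beta> * \<alpha> * \<mu> / M)) * (f x - (INF x. f x))"
proof -
  let ?g = "grad f x" and ?gap = "f x - (INF x. f x)"
  have gap0: "?gap \<ge> 0"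
    using strongly_convex_INF_le[OF sc, of x] by simp
  note pl = strongly_convex_gap_le_gradient[OF sc, of x]
  show ?thesis
  proof (cases "?g = 0")
    case True
    then have "?gap = 0"
      using pl gap0 sc(2) by (simp add: mult_le_0_iff)
    then show ?thesis
      using True by simp
  next
    case False
    note search = armijo_search_brackets[OF \<beta> s0, of "1 / M" f \<alpha> x "2 / \<mu>",
        OF _ armijo_if_short_step[OF diff sc lip] not_armijo_if_long_step[OF sc False \<alpha>(1)]]
    have "armijo f \<alpha> x \<eta>"
      unfolding \<eta>[OF False] by (rule search(1)) (use M \<alpha> in auto)
    moreover have \<eta>_gt: "\<beta> * (1 / M) < \<eta>"
      unfolding \<eta>[OF False] by (rule search(2)) (use M \<alpha> in auto)
    ultimately have "f (x - \<eta> *\<^sub>R ?g) \<le> f x - \<alpha> * \<eta> * (norm ?g)\<^sup>2"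
      by (simp add: armijo_def)
    also have "\<dots> \<le> f x - \<alpha> * (\<beta> * (1 / M)) * (2 * \<mu> * ?gap)"
    proof -
      have "0 < \<beta> * (1 / M)"
        using \<beta> M by simp
      then have "\<alpha> * (\<beta> * (1 / M)) * (2 * \<mu> * ?gap) \<le> \<alpha> * \<eta> * (norm ?g)\<^sup>2"
        using \<eta>_gt \<alpha> sc(2) gap0 pl by (intro mult_mono) auto
      then show ?thesis by simp
    qed
    finally have "f (x - \<eta> *\<^sub>R ?g) - (INF x. f x) \<le> (1 + - (2 * \<beta> * \<alpha> * \<mu> / M)) * ?gap"
      by (simp add: algebra_simps diff_divide_distrib)
    also have "\<dots> \<le> exp (- (2 * \<beta> * \<alpha> * \<mu> / M)) * ?gap"
      by (intro mult_right_mono gap0 exp_ge_add_one_self)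
    finally show ?thesis .
  qed
qed

lemma exp_contraction_reaches:
  fixes d :: "nat \<Rightarrow> real"
  assumes step: "\<And>t. d (Suc t) \<le> exp (- k) * d t"
    and "d 0 \<le> D" "D > 0" "k > 0" "e > 0" and n: "real n \<ge> ln (D / e) / k"
  shows "d n \<le> e"
proof -
  have "d n \<le> exp (- k * real n) * D"
  proof (induction n)
    case (Suc n)
    have "d (Suc n) \<le> exp (- k) * d n"
      by (rule step)
    also have "\<dots> \<le> exp (- k) * (exp (- k * real n) * D)"
      by (intro mult_left_mono Suc) simp
    also have "\<dots> = exp (- k * real (Suc n)) * D"
      by (simp add: exp_add[symmetric] algebra_simps)
    finally show ?case .
  qed (use assms in simp)
  also have "exp (- k * real n) \<le> exp (ln (e / D))"
    using n assms(3-5) by (simp add: ln_div field_simps)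
  then have "exp (- k * real n) * D \<le> e"
    using assms(3,5) by (simp add: field_simps)
  finally show ?thesis .
qed


theorem theorem2:
  fixes f :: "real ^ 'n \<Rightarrow> real"
    and L Lstar \<delta> \<mu> \<alpha> \<beta> \<epsilon> fstar \<Delta>\<^sub>0 :: real
    and w :: "nat \<Rightarrow> real ^ 'n"
    and \<eta> \<eta>init :: "nat \<Rightarrow> real"
    and T :: nat
  assumes "L > 0" "Lstar > 0" "\<delta> > 0"
    and "\<And>x. f differentiable (at x)"
    and "glocally_smooth L Lstar \<delta> f"
    and "\<mu> > 0" "strongly_convex \<mu> f"
    and "0 < \<alpha>" "\<alpha> \<le> 1 / 2" "0 < \<beta>" "\<beta> < 1"
    and "fstar = (INF x. f x)"
    and "\<Delta>\<^sub>0 = f (w 0) - fstar"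
    and "\<Delta>\<^sub>0 > \<delta>" "\<delta> > \<epsilon>" "\<epsilon> > 0"
    and "\<And>t. \<eta>init t > 0"
    and "\<And>t. grad f (w t) \<noteq> 0 \<Longrightarrow> \<eta> t = armijo_search f \<alpha> \<beta> (w t) (\<eta>init t)"
    and "\<And>t. w (Suc t) = w t - \<eta> t *\<^sub>R grad f (w t)"
    and "real T \<ge> L / (2 * \<beta> * \<alpha> * \<mu>) * ln (\<Delta>\<^sub>0 / \<delta>)
           + Lstar / (2 * \<beta> * \<alpha> * \<mu>) * ln (\<delta> / \<epsilon>) + 1"
  shows "f (w T) - fstar \<le> \<epsilon>"
proof -
  define d where "d t = f (w t) - fstar" for t
  define c where "c = 2 * \<beta> * \<alpha> * \<mu>"
  have c: "c > 0"
    unfolding c_def using assms(6,8,10) by simp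
  have contract: "d (Suc t) \<le> exp (- (c / M)) * d t"
    if "M > 0" "\<And>u. f u \<le> f (w t) \<Longrightarrow> norm (grad f u - grad f (w t)) \<le> M * norm (u - w t)"
    for t M
    unfolding d_def c_def assms(12,19)
    by (rule armijo_search_contraction[OF assms(4,7,6) that(2,1) assms(8-11,17,18)])
  have contract_L: "d (Suc t) \<le> exp (- (c / L)) * d t" for t
    using assms(5) by (intro contract assms(1)) (simp add: glocally_smooth_def)
  have d_nonneg: "d t \<ge> 0" for t
    using strongly_convex_INF_le[OF assms(7,6), of "w t"] by (simp add: d_def assms(12))
  have "d (Suc t) \<le> d t" for t
  proof -
    have "exp (- (c / L)) * d t \<le> 1 * d t"
      by (intro mult_right_mono d_nonneg) (use c assms(1) in simp)
    with contract_L[of t] show ?thesis by simp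
  qed
  then have dec: "decseq d"
    by (rule decseq_SucI)
  have d0: "d 0 = \<Delta>\<^sub>0"
    by (simp add: d_def assms(13))
  define N where "N = nat \<lceil>ln (\<Delta>\<^sub>0 / \<delta>) / (c / L)\<rceil>"
  have N_ge: "real N \<ge> ln (\<Delta>\<^sub>0 / \<delta>) / (c / L)"
    unfolding N_def by linarith
  have "ln (\<Delta>\<^sub>0 / \<delta>) / (c / L) > 0"
    using assms(1,3,14) c by simp
  then have N_le: "real N \<le> ln (\<Delta>\<^sub>0 / \<delta>) / (c / L) + 1"
    unfolding N_def by linarith
  have T_ge: "real T \<ge> ln (\<Delta>\<^sub>0 / \<delta>) / (c / L) + ln (\<delta> / \<epsilon>) / (c / Lstar) + 1"
    using assms(20) by (simp add: c_def mult.commute)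
  have dN: "d N \<le> \<delta>"
    by (rule exp_contraction_reaches[where d = d, OF contract_L _ _ _ _ N_ge])
      (use d0 assms(1,3,14) c in auto)
  have "ln (\<delta> / \<epsilon>) / (c / Lstar) > 0"
    using assms(2,15,16) c by simp
  with N_le T_ge have NT: "N \<le> T" and rest: "real (T - N) \<ge> ln (\<delta> / \<epsilon>) / (c / Lstar)"
    by linarith+
  have "d (N + (T - N)) \<le> \<epsilon>"
  proof (rule exp_contraction_reaches[where d = "\<lambda>t. d (N + t)", OF _ _ _ _ _ rest])
    fix t
    have "d (N + t) \<le> \<delta>"
      using decseqD[OF dec, of N "N + t"] dN by simp
    then have "d (Suc (N + t)) \<le> exp (- (c / Lstar)) * d (N + t)"
      using assms(5) by (intro contract assms(2)) (simp add: glocally_smooth_def d_def assms(12))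
    then show "d (N + Suc t) \<le> exp (- (c / Lstar)) * d (N + t)"
      by simp
  qed (use dN assms(2,3,16) c in auto)
  then show ?thesis
    using NT by (simp add: d_def)
qed

end
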